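(* Let $\hat\beta$ be the Lasso estimator with tuning parameter $\lambda>0$, i.e. a minimizer over $\beta\in\mathbb{R}^p$ of $\|Y-X\beta\|_n^2+2\lambda\|\beta\|_1$, where $Y=X\beta^0+\epsilon$. Let $\lambda_\epsilon$ satisfy $$\lambda_\epsilon\ge \|\epsilon^TX\|_\infty/n .$$ Let $0\le\delta<1$ be arbitrary and, for $\lambda>\lambda_\epsilon$, define $$L:=\frac{\lambda+\lambda_\epsilon+\delta(\lambda-\lambda_\epsilon)}{(1-\delta)(\lambda-\lambda_\epsilon)} .$$ Then $$2\delta(\lambda-\lambda_\epsilon)\|\hat\beta-\beta^0\|_1+\|X(\hat\beta-\beta^0)\|_n^2$$ $$\le \min_{S\subset\{1,\dots,p\}}\Big\{\min_{\beta\in\mathbb{R}^p,\ S_\beta=S}\Big[2\delta(\lambda-\lambda_\epsilon)\|\beta-\beta^0\|_1+\|X(\beta-\beta^0)\|_n^2\Big]+\big[\lambda+\lambda_\epsilon+\delta(\lambda-\lambda_\epsilon)\big]^2\frac{|S|}{\hat\phi^2(L,S)}\Big\}.$$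
   Context: $X$ is a fixed $n\times p$ real matrix of rank $n$, $Y\in\mathbb{R}^n$, $f^0=\mathbb{E}Y$, $\beta^0\in\mathbb{R}^p$ is a solution of $X\beta^0=f^0$, and $\epsilon:=Y-f^0$, so $Y=X\beta^0+\epsilon$ (the result is deterministic: it holds for any realization of $\epsilon$). For $v\in\mathbb{R}^n$, $\|v\|_n:=\sqrt{v^Tv/n}$. $\|\cdot\|_1$ and $\|\cdot\|_\infty$ are the $\ell_1$- and $\ell_\infty$-norms of vectors. For $\beta\in\mathbb{R}^p$, $S_\beta:=\{j:\beta_j\ne0\}$. For $S\subset\{1,\dots,p\}$, $\beta_S\in\mathbb{R}^p$ has entries $\beta_j$ for $j\in S$ and $0$ otherwise; $S^c$ is the complement of $S$. The compatibility constant, for $L>0$, is $$\hat\phi^2(L,S):=\min\{|S|\,\|X\beta_S-X\beta_{S^c}\|_n^2:\ \|\beta_S\|_1=1,\ \|\beta_{S^c}\|_1\le L\}.$$ Conventions: minima over $\beta$ with $S_\beta=S$ are understood as infima (i.e. the inequality holds for every $\beta$, with $S=S_\beta$); $|S|/\hat\phi^2(L,S)$ is $0$ if $S=\emptyset$ and $+\infty$ if $S\neq\emptyset$ and $\hat\phi(L,S)=0$. *)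

theory Defs
  imports "HOL-Analysis.Analysis"
begin

definition norm_n :: "real ^ 'n \<Rightarrow> real" where
  "norm_n v = sqrt ((v \<bullet> v) / real CARD('n))"

definition l1_norm :: "real ^ 'p \<Rightarrow> real" where
  "l1_norm b = (\<Sum>j\<in>UNIV. \<bar>b $ j\<bar>)"

definition supp :: "real ^ 'p \<Rightarrow> 'p set" where
  "supp b = {j. b $ j \<noteq> 0}"

definition restr :: "real ^ 'p \<Rightarrow> 'p set \<Rightarrow> real ^ 'p" where
  "restr b S = (\<chi> j. if j \<in> S then b $ j else 0)"

definition is_lasso :: "real ^ 'p ^ 'n \<Rightarrow> real ^ 'n \<Rightarrow> real \<Rightarrow> real ^ 'p \<Rightarrow> bool" where
  "is_lasso X Y lam bhat \<longleftrightarrow>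
     is_arg_min (\<lambda>b. (norm_n (Y - X *v b))\<^sup>2 + 2 * lam * l1_norm b) (\<lambda>_. True) bhat"

text \<open>The squared compatibility constant. For nonempty \<open>S\<close> and \<open>L > 0\<close> the infimum is attained,
  see \<open>compat_sq_attained\<close> below. For empty \<open>S\<close> the constraint set is empty and the value is
  meaningless; it is never used in \<open>compat_ratio\<close>.\<close>

definition compat_sq :: "real ^ 'p ^ 'n \<Rightarrow> real \<Rightarrow> 'p set \<Rightarrow> real" where
  "compat_sq X L S =
     (INF b \<in> {b. l1_norm (restr b S) = 1 \<and> l1_norm (restr b (- S)) \<le> L}.
        real (card S) * (norm_n (X *v restr b S - X *v restr b (- S)))\<^sup>2)"

text \<open>The quotient of \<open>card S\<close> by the squared compatibility constant, with its conventions.\<close>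

definition compat_ratio :: "real ^ 'p ^ 'n \<Rightarrow> real \<Rightarrow> 'p set \<Rightarrow> ereal" where
  "compat_ratio X L S =
     (if S = {} then 0
      else if compat_sq X L S = 0 then \<infinity>
      else ereal (real (card S) / compat_sq X L S))"

lemma compat_sq_attained:
  fixes X :: "real ^ 'p ^ 'n"
  assumes "S \<noteq> {}" and "L > 0"
  shows "\<exists>b. l1_norm (restr b S) = 1 \<and> l1_norm (restr b (- S)) \<le> L \<and>
    compat_sq X L S = real (card S) * (norm_n (X *v restr b S - X *v restr b (- S)))\<^sup>2"
proof -
  let ?A = "{b :: real ^ 'p. l1_norm (restr b S) = 1 \<and> l1_norm (restr b (- S)) \<le> L}"
  let ?f = "\<lambda>b. real (card S) * (norm_n (X *v restr b S - X *v restr b (- S)))\<^sup>2"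
  have cr: "continuous_on UNIV (\<lambda>b :: real ^ 'p. restr b T)" for T
    unfolding restr_def
  proof (intro continuous_intros)
    fix j show "continuous_on UNIV (\<lambda>b :: real ^ 'p. if j \<in> T then b $ j else 0)"
      by (cases "j \<in> T") (auto intro!: continuous_intros)
  qed
  have cl: "continuous_on UNIV (\<lambda>b :: real ^ 'p. l1_norm (restr b T))" for T
    unfolding l1_norm_def by (intro continuous_intros cr)
  have cX: "continuous_on UNIV (\<lambda>b :: real ^ 'p. X *v restr b T)" for T
    using continuous_on_compose2[OF linear_continuous_on[OF matrix_vector_mul_bounded_linear] cr]
    by blast
  have cf: "continuous_on ?A ?f"
    unfolding norm_n_def
    by (rule continuous_on_subset[where s = UNIV]) (auto intro!: continuous_intros cX)
  have "closed ?A"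
    using cl by (intro closed_Collect_conj closed_Collect_eq closed_Collect_le) auto
  moreover have "bounded ?A"
  proof (rule boundedI)
    fix b assume b: "b \<in> ?A"
    have "norm b \<le> (\<Sum>j\<in>UNIV. \<bar>b $ j\<bar>)" by (rule norm_le_l1_cart)
    also have "\<dots> = l1_norm (restr b S) + l1_norm (restr b (- S))"
      unfolding l1_norm_def restr_def by (auto simp: sum.distrib[symmetric] intro!: sum.cong)
    also have "\<dots> \<le> 1 + L" using b by auto
    finally show "norm b \<le> 1 + L" .
  qed
  ultimately have "compact ?A" by (simp add: compact_eq_bounded_closed)
  moreover obtain i where i: "i \<in> S" using assms by auto
  have "axis i 1 \<in> ?A"
  proof -
    have "(\<Sum>j\<in>UNIV. \<bar>if j \<in> S then axis i (1::real) $ j else 0\<bar>) = (\<Sum>j\<in>UNIV. if j = i then 1 else 0)"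
      using i by (intro sum.cong) (auto simp: axis_def)
    moreover have "(\<Sum>j\<in>UNIV. \<bar>if j \<in> - S then axis i (1::real) $ j else 0\<bar>) = 0"
      using i by (intro sum.neutral) (auto simp: axis_def)
    ultimately show ?thesis using assms by (simp add: l1_norm_def restr_def)
  qed
  then have "?A \<noteq> {}" by blast
  ultimately obtain b where b: "b \<in> ?A" "\<forall>c\<in>?A. ?f b \<le> ?f c"
    using continuous_attains_inf[OF _ _ cf] by blast
  have "compat_sq X L S = ?f b"
    unfolding compat_sq_def using b by (intro cInf_eq_minimum) auto
  with b show ?thesis by blast
qed

end

theory Submission
  imports Defs
begin

text \<open>
  Write \<open>v = bhat - beta\<close> and \<open>S = supp beta\<close>. Convexity of the Lasso objective along the segment
  from \<open>bhat\<close> to \<open>beta\<close> gives the first-order condition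
  \<open>(Y - X bhat)\<^sup>T X (beta - bhat) / n \<le> lam (\<parallel>beta\<parallel>\<^sub>1 - \<parallel>bhat\<parallel>\<^sub>1)\<close>. Polarisation, the dual norm bound
  on the noise term and the triangle inequality on \<open>S\<close> and its complement turn it into
  \<open>\<parallel>X v\<parallel>\<^sup>2 + \<parallel>X (bhat - beta0)\<parallel>\<^sup>2 + 2 (lam - lam_eps) \<parallel>v\<^bsub>-S\<^esub>\<parallel>\<^sub>1
    \<le> \<parallel>X (beta - beta0)\<parallel>\<^sup>2 + 2 (lam + lam_eps) \<parallel>v\<^sub>S\<parallel>\<^sub>1\<close>.
  After moving a fraction \<open>delta\<close> of the slack to the \<open>\<ell>\<^sub>1\<close>-error, either the \<open>-S\<close> part absorbs the
  right-hand side, or \<open>v\<close> lies in the cone \<open>\<parallel>v\<^bsub>-S\<^esub>\<parallel>\<^sub>1 \<le> L \<parallel>v\<^sub>S\<parallel>\<^sub>1\<close>, where compatibility bounds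
  \<open>\<parallel>v\<^sub>S\<parallel>\<^sub>1\<close> by \<open>\<parallel>X v\<parallel>\<close> and \<open>2 a b \<le> a\<^sup>2 + b\<^sup>2\<close> finishes.
\<close>

lemma norm_n_squared: "(norm_n (v :: real ^ 'n))\<^sup>2 = (v \<bullet> v) / real CARD('n)"
  by (simp add: norm_n_def)

lemma l1_norm_nonneg: "0 \<le> l1_norm b"
  by (simp add: l1_norm_def sum_nonneg)

lemma l1_norm_triangle: "l1_norm (a + b) \<le> l1_norm a + l1_norm b"
  by (simp add: l1_norm_def sum.distrib[symmetric] sum_mono abs_triangle_ineq)

lemma l1_norm_scaleR: "l1_norm (c *\<^sub>R b) = \<bar>c\<bar> * l1_norm b"
  by (simp add: l1_norm_def sum_distrib_left abs_mult)

lemma l1_norm_split: "l1_norm b = l1_norm (restr b S) + l1_norm (restr b (- S))"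
  unfolding l1_norm_def restr_def by (auto simp: sum.distrib[symmetric] intro!: sum.cong)

lemma restr_split: "restr b S + restr b (- S) = b"
  by (simp add: restr_def vec_eq_iff)

lemma inner_le_infnorm_l1_norm: "(a :: real ^ 'p) \<bullet> b \<le> infnorm a * l1_norm b"
proof -
  have "a $ j * b $ j \<le> infnorm a * \<bar>b $ j\<bar>" for j
  proof -
    have "a $ j * b $ j \<le> \<bar>a $ j\<bar> * \<bar>b $ j\<bar>"
      by (metis abs_ge_self abs_mult)
    also have "\<dots> \<le> infnorm a * \<bar>b $ j\<bar>"
      by (intro mult_right_mono component_le_infnorm_cart) auto
    finally show ?thesis .
  qed
  then show ?thesis
    by (simp add: inner_vec_def l1_norm_def sum_distrib_left sum_mono)
qed

text \<open>Coordinatewise: on \<open>S\<close> this is the reverse triangle inequality; off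
  \<open>S\<close> the entry of \<open>beta\<close> vanishes and equality holds.\<close>

lemma l1_norm_diff_le_restr_supp:
  assumes "supp beta = S"
  shows "l1_norm beta - l1_norm b \<le> l1_norm (restr (b - beta) S) - l1_norm (restr (b - beta) (- S))"
proof -
  have "\<bar>beta $ j\<bar> - \<bar>b $ j\<bar> \<le> \<bar>restr (b - beta) S $ j\<bar> - \<bar>restr (b - beta) (- S) $ j\<bar>" for j
    using assms by (auto simp: restr_def supp_def)
  then show ?thesis
    unfolding l1_norm_def sum_subtractf[symmetric] by (intro sum_mono) auto
qed

text \<open>Letting \<open>t\<close> tend to 0 from the right discards the second-order term left by
  the segment argument for the Lasso.\<close>

lemma le_of_le_add_small_mult:
  fixes a b c :: real
  assumes "\<And>t. 0 < t \<Longrightarrow> t \<le> 1 \<Longrightarrow> a \<le> b + t * c"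
  shows "a \<le> b"
proof (rule tendsto_lowerbound)
  show "((\<lambda>t. b + t * c) \<longlongrightarrow> b) (at_right 0)"
    by (auto intro!: tendsto_eq_intros)
  show "\<forall>\<^sub>F t in at_right 0. a \<le> b + t * c"
    using assms by (auto simp: eventually_at_right_field intro!: exI[of _ 1])
qed simp

lemma is_lasso_first_order:
  fixes X :: "real ^ 'p ^ 'n"
  assumes "is_lasso X Y lam bhat" and "0 \<le> lam"
  shows "(Y - X *v bhat) \<bullet> (X *v (beta - bhat)) / real CARD('n) \<le> lam * (l1_norm beta - l1_norm bhat)"
proof (rule le_of_le_add_small_mult)
  fix t :: real assume t: "0 < t" "t \<le> 1"
  define N where "N = real CARD('n)"
  define r where "r = Y - X *v bhat"
  define w where "w = X *v (beta - bhat)"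
  define b where "b = (1 - t) *\<^sub>R bhat + t *\<^sub>R beta"
  have "(norm_n r)\<^sup>2 + 2 * lam * l1_norm bhat \<le> (norm_n (Y - X *v b))\<^sup>2 + 2 * lam * l1_norm b"
    using assms(1) unfolding is_lasso_def is_arg_min_def r_def by (meson linorder_not_less)
  moreover have "Y - X *v b = r - t *\<^sub>R w"
    unfolding b_def r_def w_def
    by (simp add: matrix_vector_right_distrib matrix_vector_mult_diff_distrib
        matrix_vector_mult_scaleR algebra_simps)
  moreover have "l1_norm b \<le> (1 - t) * l1_norm bhat + t * l1_norm beta"
    using l1_norm_triangle[of "(1 - t) *\<^sub>R bhat" "t *\<^sub>R beta"] t by (simp add: b_def l1_norm_scaleR)
  then have "lam * l1_norm b \<le> lam * ((1 - t) * l1_norm bhat + t * l1_norm beta)"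
    using assms(2) by (rule mult_left_mono)
  ultimately have "(r \<bullet> r) / N \<le> ((r - t *\<^sub>R w) \<bullet> (r - t *\<^sub>R w)) / N
      + 2 * (lam * (t * (l1_norm beta - l1_norm bhat)))"
    by (simp add: norm_n_squared N_def algebra_simps)
  also have "(r - t *\<^sub>R w) \<bullet> (r - t *\<^sub>R w) = r \<bullet> r - 2 * t * (r \<bullet> w) + t * t * (w \<bullet> w)"
    by (simp add: inner_diff_left inner_diff_right inner_commute algebra_simps)
  \<comment> \<open>Every surviving term carries a factor \<open>t\<close>; cancelling
    \<open>2 * t\<close> leaves an error linear in \<open>t\<close>.\<close>
  finally have "2 * t * (r \<bullet> w / N)
      \<le> 2 * t * (lam * (l1_norm beta - l1_norm bhat) + t * ((w \<bullet> w) / N / 2))"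
    by (simp add: add_divide_distrib diff_divide_distrib algebra_simps)
  then show "r \<bullet> w / real CARD('n)
      \<le> lam * (l1_norm beta - l1_norm bhat) + t * ((w \<bullet> w) / N / 2)"
    unfolding N_def[symmetric] by (rule mult_left_le_imp_le) (use t in simp)
qed

lemma is_lasso_basic_inequality:
  fixes X :: "real ^ 'p ^ 'n"
  assumes lasso: "is_lasso X Y lam bhat" and lam: "0 \<le> lam"
    and noise: "infnorm ((Y - X *v beta0) v* X) / real CARD('n) \<le> lam_eps"
    and S: "supp beta = S"
  shows "(norm_n (X *v (bhat - beta)))\<^sup>2 + (norm_n (X *v (bhat - beta0)))\<^sup>2
      + 2 * (lam - lam_eps) * l1_norm (restr (bhat - beta) (- S))
    \<le> (norm_n (X *v (beta - beta0)))\<^sup>2 + 2 * (lam + lam_eps) * l1_norm (restr (bhat - beta) S)"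
proof -
  define N where "N = real CARD('n)"
  define e where "e = Y - X *v beta0"
  define v where "v = bhat - beta"
  define p where "p = X *v v"
  define h where "h = X *v (bhat - beta0)"
  have N: "N > 0" by (simp add: N_def)
  have "e \<bullet> p = (e v* X) \<bullet> v"
    by (simp add: p_def dot_lmul_matrix)
  also have "\<dots> \<le> infnorm (e v* X) * l1_norm v"
    by (rule inner_le_infnorm_l1_norm)
  finally have "e \<bullet> p / N \<le> infnorm (e v* X) / N * l1_norm v"
    using N by (simp add: divide_right_mono)
  also have "\<dots> \<le> lam_eps * l1_norm v"
    using noise by (intro mult_right_mono l1_norm_nonneg) (simp add: N_def e_def)
  finally have noise': "e \<bullet> p / N \<le> lam_eps * (l1_norm (restr v S) + l1_norm (restr v (- S)))"
    using l1_norm_split[of v S] by simp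
  have "Y - X *v bhat = e - h" "X *v (beta - bhat) = - p" "X *v (beta - beta0) = h - p"
    by (simp_all add: e_def h_def p_def v_def matrix_vector_mult_diff_distrib)
  moreover from this have "(e - h) \<bullet> (- p) / N \<le> lam * (l1_norm beta - l1_norm bhat)"
    using is_lasso_first_order[OF lasso lam, of beta] by (simp add: N_def)
  moreover have "lam * (l1_norm beta - l1_norm bhat)
      \<le> lam * (l1_norm (restr v S) - l1_norm (restr v (- S)))"
    unfolding v_def using l1_norm_diff_le_restr_supp[OF S] lam by (rule mult_left_mono)
  moreover have "(e - h) \<bullet> (- p) / N = h \<bullet> p / N - e \<bullet> p / N"
    by (simp add: inner_diff_left diff_divide_distrib)
  \<comment> \<open>Polarisation trades the cross term \<open>h \<bullet> p\<close> for the three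
    squared prediction norms.\<close>
  moreover have "(h - p) \<bullet> (h - p) / N = h \<bullet> h / N - 2 * (h \<bullet> p / N) + p \<bullet> p / N"
    by (simp add: inner_diff_left inner_diff_right inner_commute add_divide_distrib diff_divide_distrib)
  ultimately show ?thesis
    using noise' unfolding norm_n_squared v_def[symmetric] p_def[symmetric] h_def[symmetric]
      N_def[symmetric] distrib_left distrib_right left_diff_distrib right_diff_distrib
    by simp
qed

text \<open>The definition constrains \<open>X b\<^sub>S - X b\<^bsub>-S\<^esub>\<close>, so it is applied to \<open>v\<close> with the sign of its
  \<open>-S\<close> part flipped.\<close>

lemma compat_sq_le:
  fixes X :: "real ^ 'p ^ 'n"
  assumes pos: "0 < l1_norm (restr v S)"
    and cone: "l1_norm (restr v (- S)) \<le> L * l1_norm (restr v S)"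
  shows "(l1_norm (restr v S))\<^sup>2 * compat_sq X L S \<le> real (card S) * (norm_n (X *v v))\<^sup>2"
proof -
  define s where "s = l1_norm (restr v S)"
  define b where "b = (1 / s) *\<^sub>R (restr v S - restr v (- S))"
  have s: "s > 0" using pos by (simp add: s_def)
  have bS: "restr b S = (1 / s) *\<^sub>R restr v S" and bC: "restr b (- S) = (- 1 / s) *\<^sub>R restr v (- S)"
    by (simp_all add: b_def restr_def vec_eq_iff)
  have "l1_norm (restr b S) = 1"
    using s unfolding bS l1_norm_scaleR by (simp add: s_def)
  moreover have "l1_norm (restr b (- S)) \<le> L"
    using s cone unfolding bC l1_norm_scaleR by (simp add: s_def[symmetric] field_simps)
  ultimately have "compat_sq X L S
      \<le> real (card S) * (norm_n (X *v restr b S - X *v restr b (- S)))\<^sup>2"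
    unfolding compat_sq_def by (intro cINF_lower bdd_belowI[of _ 0]) auto
  also have "restr b S - restr b (- S) = (1 / s) *\<^sub>R v"
    using restr_split[of v S] unfolding bS bC by (simp flip: scaleR_right_distrib)
  then have "X *v restr b S - X *v restr b (- S) = (1 / s) *\<^sub>R (X *v v)"
    by (metis matrix_vector_mult_diff_distrib matrix_vector_mult_scaleR)
  also have "(norm_n ((1 / s) *\<^sub>R (X *v v)))\<^sup>2 = (norm_n (X *v v))\<^sup>2 / s\<^sup>2"
    unfolding norm_n_squared by (simp add: power2_eq_square)
  finally show ?thesis
    using s by (simp add: s_def[symmetric] field_simps)
qed

text \<open>A real \<open>INF\<close> is informative only over a nonempty set; attainment gives a
  minimiser, whose value is a multiple of a square.\<close>

lemma compat_sq_nonneg: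
  assumes "S \<noteq> {}" and "L > 0"
  shows "0 \<le> compat_sq X L S"
  using compat_sq_attained[OF assms, of X] by auto

lemma compat_ratio_nonneg:
  assumes "L > 0"
  shows "0 \<le> compat_ratio X L S"
  using assms by (simp add: compat_ratio_def compat_sq_nonneg)

lemma is_lasso_oracle_inequality:
  fixes X :: "real ^ 'p ^ 'n"
  assumes lasso: "is_lasso X Y lam bhat" and lam: "0 \<le> lam"
    and noise: "infnorm ((Y - X *v beta0) v* X) / real CARD('n) \<le> lam_eps"
    and delta: "0 \<le> delta" "delta < 1" and gap: "lam_eps < lam"
    and A: "A = lam + lam_eps + delta * (lam - lam_eps)"
    and L: "L = A / ((1 - delta) * (lam - lam_eps))"
    and S: "supp beta = S"
  shows "ereal (2 * delta * (lam - lam_eps) * l1_norm (bhat - beta0)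
                + (norm_n (X *v (bhat - beta0)))\<^sup>2)
    \<le> ereal (2 * delta * (lam - lam_eps) * l1_norm (beta - beta0)
                + (norm_n (X *v (beta - beta0)))\<^sup>2)
      + ereal (A\<^sup>2) * compat_ratio X L S"
    (is "ereal ?lhs \<le> ereal ?rhs + _")
proof -
  define d where "d = lam - lam_eps"
  define v where "v = bhat - beta"
  define s where "s = l1_norm (restr v S)"
  define c where "c = l1_norm (restr v (- S))"
  define x where "x = (norm_n (X *v v))\<^sup>2"
  have d: "d > 0" using gap by (simp add: d_def)
  \<comment> \<open>As a bound on a norm, \<open>lam_eps\<close> is nonnegative, which makes
    \<open>A\<close> and \<open>L\<close> positive.\<close>
  have "0 \<le> infnorm ((Y - X *v beta0) v* X) / real CARD('n)"
    by (simp add: infnorm_pos_le)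
  then have "0 \<le> lam_eps" using noise by linarith
  then have A_pos: "A > 0" using gap delta by (simp add: A add_pos_nonneg)
  have dd: "0 < (1 - delta) * d" using d delta by simp
  have L_pos: "L > 0" using A_pos dd by (simp add: L d_def)
  have "l1_norm (bhat - beta0) \<le> l1_norm v + l1_norm (beta - beta0)"
    using l1_norm_triangle[of v "beta - beta0"] by (simp add: v_def)
  also have "l1_norm v = s + c"
    unfolding s_def c_def by (rule l1_norm_split)
  finally have "delta * d * l1_norm (bhat - beta0) \<le> delta * d * (s + c + l1_norm (beta - beta0))"
    using delta d by (intro mult_left_mono) auto
  moreover have "x + (norm_n (X *v (bhat - beta0)))\<^sup>2 + 2 * d * c
      \<le> (norm_n (X *v (beta - beta0)))\<^sup>2 + 2 * (lam + lam_eps) * s"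
    using is_lasso_basic_inequality[OF lasso lam noise S]
    by (simp add: x_def d_def c_def s_def v_def)
  \<comment> \<open>Paying \<open>2 * delta * d * (s + c)\<close> for the l1-error lowers the
    coefficient of \<open>c\<close> to \<open>2 * (1 - delta) * d\<close> and raises that of
    \<open>s\<close> to \<open>2 * A\<close>; \<open>L\<close> is the ratio of the two.\<close>
  ultimately have key: "?lhs + x + 2 * ((1 - delta) * d * c) \<le> ?rhs + 2 * (A * s)"
    unfolding A d_def[symmetric] by (simp add: algebra_simps)
  show ?thesis
  proof (cases "A * s \<le> (1 - delta) * d * c")
    case True
    have "0 \<le> x" by (simp add: x_def)
    with key True have "?lhs \<le> ?rhs" by linarith
    moreover have "0 \<le> ereal (A\<^sup>2) * compat_ratio X L S"
      using compat_ratio_nonneg[OF L_pos] by (intro ereal_0_le_mult) auto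
    ultimately show ?thesis
      by (metis add.right_neutral add_mono ereal_less_eq(3))
  next
    case False
    have c: "0 \<le> c" by (simp add: c_def l1_norm_nonneg)
    have "0 \<le> (1 - delta) * d * c" using dd c by simp
    with False have "0 < A * s" by linarith
    with A_pos have s: "0 < s" by (simp add: zero_less_mult_iff)
    have "c \<le> L * s"
      using False dd unfolding L d_def[symmetric] by (simp add: field_simps)
    then have compat: "s\<^sup>2 * compat_sq X L S \<le> real (card S) * x"
      using compat_sq_le[of v S L X] s by (simp add: s_def c_def x_def)
    have ne: "S \<noteq> {}"
      using s by (auto simp: s_def l1_norm_def restr_def)
    show ?thesis
    proof (cases "compat_sq X L S = 0")
      case True
      \<comment> \<open>Since \<open>A > 0\<close>, the product with the infinite ratio is infinite
        rather than 0.\<close>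
      then show ?thesis using ne A_pos by (simp add: compat_ratio_def)
    next
      case False
      with compat_sq_nonneg[OF ne L_pos] have q: "0 < compat_sq X L S"
        by (metis less_eq_real_def)
      define r where "r = real (card S) / compat_sq X L S"
      have r: "0 < r" using ne q by (simp add: r_def card_gt_0_iff)
      have "s\<^sup>2 / r \<le> x"
        using compat r q by (simp add: r_def field_simps)
      \<comment> \<open>Weighted form of 2ab \<le> a^2 + b^2, with a^2 =
        \<open>s\<^sup>2 / r\<close> and b^2 = \<open>A\<^sup>2 * r\<close>.\<close>
      moreover have "0 \<le> (s - A * r)\<^sup>2 / r" using r by simp
      moreover have "(s - A * r)\<^sup>2 / r = s\<^sup>2 / r - 2 * (A * s) + A\<^sup>2 * r"
        using r by (simp add: power2_eq_square field_simps)
      ultimately have "2 * (A * s) \<le> x + A\<^sup>2 * r" by linarith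
      moreover have "0 \<le> (1 - delta) * d * c" by fact
      ultimately have "?lhs \<le> ?rhs + A\<^sup>2 * r" using key by linarith
      then show ?thesis using ne False by (simp add: compat_ratio_def r_def)
    qed
  qed
qed

theorem theorem1p3p2:
  fixes X :: "real ^ 'p ^ 'n"
    and Y f0 eps :: "real ^ 'n"
    and beta0 bhat :: "real ^ 'p"
    and lam lam_eps delta L :: real
  assumes "rank X = CARD('n)"
    and "X *v beta0 = f0"
    and "eps = Y - f0"
    and "lam > 0"
    and "is_lasso X Y lam bhat"
    and "lam_eps \<ge> infnorm (eps v* X) / real CARD('n)"
    and "0 \<le> delta" and "delta < 1"
    and "lam > lam_eps"
    and "L = (lam + lam_eps + delta * (lam - lam_eps)) / ((1 - delta) * (lam - lam_eps))"
  shows "ereal (2 * delta * (lam - lam_eps) * l1_norm (bhat - beta0)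
                + (norm_n (X *v (bhat - beta0)))\<^sup>2)
    \<le> (MIN S \<in> (UNIV :: 'p set set).
         (INF beta \<in> {beta. supp beta = S}.
            ereal (2 * delta * (lam - lam_eps) * l1_norm (beta - beta0)
                   + (norm_n (X *v (beta - beta0)))\<^sup>2))
         + ereal ((lam + lam_eps + delta * (lam - lam_eps))\<^sup>2) * compat_ratio X L S)"
proof -
  let ?A = "lam + lam_eps + delta * (lam - lam_eps)"
  let ?R = "\<lambda>beta. ereal (2 * delta * (lam - lam_eps) * l1_norm (beta - beta0)
                   + (norm_n (X *v (beta - beta0)))\<^sup>2)"
  have "?R bhat \<le> (INF beta \<in> {beta. supp beta = S}. ?R beta) + ereal (?A\<^sup>2) * compat_ratio X L S"
    for S :: "'p set"
  proof -
    have ex: "{beta :: real ^ 'p. supp beta = S} \<noteq> {}"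
      by (auto simp: supp_def split: if_splits intro!: exI[of _ "\<chi> j. if j \<in> S then 1 else 0"])
    have le: "?R bhat \<le> ?R beta + ereal (?A\<^sup>2) * compat_ratio X L S" if "supp beta = S" for beta
      using assms that
      by (intro is_lasso_oracle_inequality[OF assms(5) _ _ assms(7,8,9) refl]) auto
    show ?thesis
    \<comment> \<open>Moving the infimum past an extended-real summand: a finite one is subtracted,
      an infinite one dominates because the infimum is nonnegative, and minus infinity would
      contradict \<open>le\<close> at a vector with support \<open>S\<close>.\<close>
    proof (cases "ereal (?A\<^sup>2) * compat_ratio X L S")
      case (real r)
      have "?R bhat - ereal r \<le> (INF beta \<in> {beta. supp beta = S}. ?R beta)"
        using le real by (intro INF_greatest) (fastforce simp: diff_le_eq)
      then show ?thesis unfolding real by (subst (asm) ereal_minus_le) auto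
    next
      case PInf
      have "0 \<le> (INF beta \<in> {beta. supp beta = S}. ?R beta)"
        using assms by (intro INF_greatest) (auto intro!: add_nonneg_nonneg mult_nonneg_nonneg l1_norm_nonneg)
      then show ?thesis unfolding PInf by auto
    next
      case MInf
      then show ?thesis using le ex by fastforce
    qed
  qed
  then show ?thesis
    by (intro Min.boundedI) auto
qed

end
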